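(* If $G$ and $G'$ are non-isomorphic graphs that have the same order $n$, then $\mathrm{D}_1(G,G')\le (n+3)/2$.
   Context: Graphs are finite, undirected and loopless; the order is the number of vertices. A graph is regarded as a structure with a single irreflexive symmetric binary predicate $E$ (adjacency). First order formulas use $E$, $=$ and the connectives $\neg,\wedge,\vee$. A closed formula $\Phi$ distinguishes $G$ from $G'$ if it is true on $G$ and false on $G'$. The set $\mathrm{Nest}(\Phi)$ of sequences of nested quantifiers is defined inductively: $\mathrm{Nest}(\Phi)=\{\epsilon\}$ (the empty word) for atomic $\Phi$; $\mathrm{Nest}(\neg\Phi)$ is obtained from $\mathrm{Nest}(\Phi)$ by exchanging $\exists$ and $\forall$ in all words; $\mathrm{Nest}(\Phi\wedge\Psi)=\mathrm{Nest}(\Phi\vee\Psi)=\mathrm{Nest}(\Phi)\cup\mathrm{Nest}(\Psi)$; $\mathrm{Nest}(\exists x\Phi)$ and $\mathrm{Nest}(\forall x\Phi)$ are obtained by prepending $\exists$, respectively $\forall$, to every word of $\mathrm{Nest}(\Phi)$. The quantifier rank of $\Phi$ is the maximum length of a word in $\mathrm{Nest}(\Phi)$; the alternation number of $\Phi$ is the maximum, over words in $\mathrm{Nest}(\Phi)$, of the number of occurrences of $\exists\forall$ and $\forall\exists$ as consecutive letters. $\mathrm{D}_k(G,G')$ is the minimum quantifier rank of a formula with alternation number at most $k$ distinguishing $G$ from $G'$. *)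

theory Defs
  imports "Graph_Theory.Graph_Theory" "HOL-Library.Extended_Real"
begin

text \<open>
  A finite simple undirected graph is a \<open>pair_graph\<close>: its arc set \<open>parcs G\<close> is a symmetric
  irreflexive relation on the finite vertex set \<open>pverts G\<close>, i.e. the interpretation of the binary
  predicate \<open>E\<close>. For such graphs the library's \<open>digraph_iso\<close> is the usual notion of isomorphism:
\<close>

lemma digraph_iso_pair_graph_iff:
  fixes G :: "'a pair_pre_digraph" and H :: "'b pair_pre_digraph"
  assumes G: "pair_graph G" and H: "pair_graph H"
  shows "digraph_iso (with_proj G) (with_proj H) \<longleftrightarrow>
    (\<exists>f. bij_betw f (pverts G) (pverts H) \<and>
      (\<forall>u\<in>pverts G. \<forall>v\<in>pverts G. (u, v) \<in> parcs G \<longleftrightarrow> (f u, f v) \<in> parcs H))"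
    (is "?L \<longleftrightarrow> (\<exists>f. ?P f)")
proof -
  interpret G: pair_graph G by (rule G)
  interpret H: pair_graph H by (rule H)
  show ?thesis
  proof
    assume ?L
    then obtain h where h: "G.digraph_isomorphism h" and eq: "with_proj H = app_iso h (with_proj G)"
      unfolding digraph_iso_def by blast
    let ?f = "iso_verts h"
    have V: "pverts H = ?f ` pverts G" and A: "parcs H = iso_arcs h ` parcs G"
      and T: "iso_tail h = fst" and D: "iso_head h = snd"
      using arg_cong[OF eq, of verts] arg_cong[OF eq, of arcs]
        arg_cong[OF eq, of tail] arg_cong[OF eq, of head] by simp_all
    have inj: "inj_on ?f (pverts G)"
      using h unfolding G.digraph_isomorphism_def by simp
    have arc: "iso_arcs h e = (?f (fst e), ?f (snd e))" if "e \<in> parcs G" for e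
      using h that unfolding G.digraph_isomorphism_def by (auto simp: T D prod_eq_iff)
    have "(u, v) \<in> parcs G \<longleftrightarrow> (?f u, ?f v) \<in> parcs H"
      if uv: "u \<in> pverts G" "v \<in> pverts G" for u v
    proof
      assume "(u, v) \<in> parcs G"
      then show "(?f u, ?f v) \<in> parcs H" using arc[of "(u, v)"] A by force
    next
      assume "(?f u, ?f v) \<in> parcs H"
      then obtain e where e: "e \<in> parcs G" "(?f u, ?f v) = iso_arcs h e" using A by auto
      then have "?f u = ?f (fst e)" "?f v = ?f (snd e)" using arc by auto
      then have "u = fst e" "v = snd e"
        using inj uv e(1) G.arc_fst_in_verts G.arc_snd_in_verts by (auto dest: inj_onD)
      then show "(u, v) \<in> parcs G" using e(1) by simp
    qed
    then show "\<exists>f. ?P f" using inj V by (intro exI[of _ ?f]) (auto simp: bij_betw_def)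
  next
    assume "\<exists>f. ?P f"
    then obtain f where f: "?P f" by blast
    then have inj: "inj_on f (pverts G)" and V: "pverts H = f ` pverts G"
      by (auto simp: bij_betw_def)
    let ?h = "\<lparr> iso_verts = f, iso_arcs = map_prod f f, iso_head = snd, iso_tail = fst \<rparr>"
    have "inj_on (map_prod f f) (parcs G)"
      using inj G.in_arcsD1 G.in_arcsD2 by (auto simp: inj_on_def)
    then have "G.digraph_isomorphism ?h"
      using inj G.wf_digraph unfolding G.digraph_isomorphism_def by auto
    moreover have "parcs H = map_prod f f ` parcs G"
    proof
      show "parcs H \<subseteq> map_prod f f ` parcs G"
      proof
        fix e assume e: "e \<in> parcs H"
        then have "fst e \<in> f ` pverts G" "snd e \<in> f ` pverts G"
          using H.arc_fst_in_verts H.arc_snd_in_verts V by auto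
        then obtain u v where uv: "u \<in> pverts G" "v \<in> pverts G" "e = (f u, f v)"
          by (metis imageE prod.collapse)
        then have "(u, v) \<in> parcs G" using f e by blast
        then show "e \<in> map_prod f f ` parcs G" using uv(3) by force
      qed
      show "map_prod f f ` parcs G \<subseteq> parcs H"
      proof
        fix e assume "e \<in> map_prod f f ` parcs G"
        then obtain u v where uv: "(u, v) \<in> parcs G" "e = (f u, f v)" by auto
        then show "e \<in> parcs H"
          using f G.in_arcsD1[OF uv(1)] G.in_arcsD2[OF uv(1)] by blast
      qed
    qed
    then have "with_proj H = app_iso ?h (with_proj G)"
      using V by (simp add: app_iso_def with_proj_def)
    ultimately show ?L unfolding digraph_iso_def by blast
  qed
qed

datatype fo_formula =
    Equal nat nat
  | Adj nat nat
  | Neg fo_formula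
  | Conj fo_formula fo_formula
  | Disj fo_formula fo_formula
  | Exi nat fo_formula
  | Uni nat fo_formula

fun free_vars :: "fo_formula \<Rightarrow> nat set" where
  "free_vars (Equal x y) = {x, y}"
| "free_vars (Adj x y) = {x, y}"
| "free_vars (Neg \<Phi>) = free_vars \<Phi>"
| "free_vars (Conj \<Phi> \<Psi>) = free_vars \<Phi> \<union> free_vars \<Psi>"
| "free_vars (Disj \<Phi> \<Psi>) = free_vars \<Phi> \<union> free_vars \<Psi>"
| "free_vars (Exi x \<Phi>) = free_vars \<Phi> - {x}"
| "free_vars (Uni x \<Phi>) = free_vars \<Phi> - {x}"

definition closed_formula :: "fo_formula \<Rightarrow> bool" where
  "closed_formula \<Phi> \<longleftrightarrow> free_vars \<Phi> = {}"

fun sat :: "'a pair_pre_digraph \<Rightarrow> (nat \<Rightarrow> 'a) \<Rightarrow> fo_formula \<Rightarrow> bool" where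
  "sat G s (Equal x y) \<longleftrightarrow> s x = s y"
| "sat G s (Adj x y) \<longleftrightarrow> (s x, s y) \<in> parcs G"
| "sat G s (Neg \<Phi>) \<longleftrightarrow> \<not> sat G s \<Phi>"
| "sat G s (Conj \<Phi> \<Psi>) \<longleftrightarrow> sat G s \<Phi> \<and> sat G s \<Psi>"
| "sat G s (Disj \<Phi> \<Psi>) \<longleftrightarrow> sat G s \<Phi> \<or> sat G s \<Psi>"
| "sat G s (Exi x \<Phi>) \<longleftrightarrow> (\<exists>v\<in>pverts G. sat G (s(x := v)) \<Phi>)"
| "sat G s (Uni x \<Phi>) \<longleftrightarrow> (\<forall>v\<in>pverts G. sat G (s(x := v)) \<Phi>)"

lemma sat_cong: "(\<And>x. x \<in> free_vars \<Phi> \<Longrightarrow> s x = t x) \<Longrightarrow> sat G s \<Phi> \<longleftrightarrow> sat G t \<Phi>"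
proof (induction \<Phi> arbitrary: s t)
  case (Exi x \<Phi>)
  have "sat G (s(x := v)) \<Phi> \<longleftrightarrow> sat G (t(x := v)) \<Phi>" for v
    using Exi.prems by (intro Exi.IH) auto
  then show ?case by simp
next
  case (Uni x \<Phi>)
  have "sat G (s(x := v)) \<Phi> \<longleftrightarrow> sat G (t(x := v)) \<Phi>" for v
    using Uni.prems by (intro Uni.IH) auto
  then show ?case by simp
next
  case (Neg \<Phi>)
  from Neg.IH[of s t] Neg.prems show ?case by simp
next
  case (Conj \<Phi> \<Psi>)
  from Conj.IH(1)[of s t] Conj.IH(2)[of s t] Conj.prems show ?case by simp
next
  case (Disj \<Phi> \<Psi>)
  from Disj.IH(1)[of s t] Disj.IH(2)[of s t] Disj.prems show ?case by simp
qed simp_all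

text \<open>
  The truth value of a closed formula does not depend on the assignment, so the quantifier over
  \<open>s\<close> below only serves to get rid of it. It ranges over all functions into the vertex
  type, not just those into \<open>pverts G\<close>, so that it is never vacuous.
\<close>

definition true_on :: "'a pair_pre_digraph \<Rightarrow> fo_formula \<Rightarrow> bool" where
  "true_on G \<Phi> \<longleftrightarrow> (\<forall>s. sat G s \<Phi>)"

lemma true_on_closed: "closed_formula \<Phi> \<Longrightarrow> true_on G \<Phi> \<longleftrightarrow> sat G s \<Phi>"
  unfolding true_on_def closed_formula_def using sat_cong by (metis empty_iff)

definition distinguishes ::
  "fo_formula \<Rightarrow> 'a pair_pre_digraph \<Rightarrow> 'b pair_pre_digraph \<Rightarrow> bool" where
  "distinguishes \<Phi> G G' \<longleftrightarrow> closed_formula \<Phi> \<and> true_on G \<Phi> \<and> \<not> true_on G' \<Phi>"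

datatype quantifier = QEx | QAll

fun exchange :: "quantifier \<Rightarrow> quantifier" where
  "exchange QEx = QAll"
| "exchange QAll = QEx"

fun Nest :: "fo_formula \<Rightarrow> quantifier list set" where
  "Nest (Equal x y) = {[]}"
| "Nest (Adj x y) = {[]}"
| "Nest (Neg \<Phi>) = map exchange ` Nest \<Phi>"
| "Nest (Conj \<Phi> \<Psi>) = Nest \<Phi> \<union> Nest \<Psi>"
| "Nest (Disj \<Phi> \<Psi>) = Nest \<Phi> \<union> Nest \<Psi>"
| "Nest (Exi x \<Phi>) = (#) QEx ` Nest \<Phi>"
| "Nest (Uni x \<Phi>) = (#) QAll ` Nest \<Phi>"

text \<open>The maxima below are thus over finite nonempty sets:\<close>

lemma finite_Nest: "finite (Nest \<Phi>)"
  by (induction \<Phi>) auto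

lemma Nest_nonempty: "Nest \<Phi> \<noteq> {}"
  by (induction \<Phi>) auto

definition quantifier_rank :: "fo_formula \<Rightarrow> nat" where
  "quantifier_rank \<Phi> = Max (length ` Nest \<Phi>)"

definition word_alternations :: "quantifier list \<Rightarrow> nat" where
  "word_alternations w = card {i. Suc i < length w \<and> w ! i \<noteq> w ! Suc i}"

definition alternation_number :: "fo_formula \<Rightarrow> nat" where
  "alternation_number \<Phi> = Max (word_alternations ` Nest \<Phi>)"

text \<open>
  The minimum is taken in \<open>enat\<close>, so that it is \<open>\<infinity>\<close>, rather than \<open>0\<close>, if there is no such formula;
  otherwise it is attained, as \<open>enat\<close> is well-ordered.
\<close>

definition D :: "nat \<Rightarrow> 'a pair_pre_digraph \<Rightarrow> 'b pair_pre_digraph \<Rightarrow> enat" where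
  "D k G G' =
    (INF \<Phi>\<in>{\<Phi>. distinguishes \<Phi> G G' \<and> alternation_number \<Phi> \<le> k}. enat (quantifier_rank \<Phi>))"

end

theory Submission
  imports Defs
begin

text \<open>
  Spoiler first selects a set \<open>X\<close> of vertices of \<open>G\<close>, maximal such that the vertices outside \<open>X\<close>
  realize more than \<open>|X|\<close> adjacency types over \<open>X\<close>; then \<open>2|X| + 1 \<le> n\<close>. By maximality, a vertex
  sharing its type with another one does not distinguish two vertices of equal type. Two more moves
  force Duplicator's reply to have the same types, with the same vertices alone in their type
  (``single'') and the same adjacencies between types. So \<open>G\<close> and \<open>G'\<close> can differ only in the number of
  vertices having some full type, i.e. type together with adjacencies to single vertices.
  As the orders are equal, some full type \<open>p\<close> is more frequent in \<open>G\<close> and some \<open>q\<close> is more frequent in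
  \<open>G'\<close>. Spoiler exhausts the smaller of the class of \<open>p\<close> in \<open>G'\<close> and the class of \<open>q\<close> in \<open>G\<close>, selecting
  one vertex more in the other graph and never changing graphs again, so that Duplicator replies somewhere with a wrong full type.
  This takes a further move to exploit only if some type splits into several full types, but then
  there is one more class and the smaller class is bounded accordingly.
\<close>

section \<open>Separating formulas with prescribed quantifier words\<close>

text \<open>The vertices selected so far are the values of the variables \<open>0\<close>,
  \<open>1\<close>, ... in order. The set \<open>W\<close> of allowed words controls quantifier rank
  and alternation number at once.\<close>

definition separable ::
  "quantifier list set \<Rightarrow> 'a pair_pre_digraph \<Rightarrow> 'a list \<Rightarrow> 'b pair_pre_digraph \<Rightarrow> 'b list \<Rightarrow> bool" where
  "separable W G xs G' ys \<longleftrightarrow>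
    (\<exists>\<Phi>. free_vars \<Phi> \<subseteq> {..<length xs} \<and> Nest \<Phi> \<subseteq> W \<and> sat G ((!) xs) \<Phi> \<and> \<not> sat G' ((!) ys) \<Phi>)"

lemma separable_mono: "separable W G xs G' ys \<Longrightarrow> W \<subseteq> W' \<Longrightarrow> separable W' G xs G' ys"
  unfolding separable_def by (meson subset_trans)

text \<open>Negation turns Spoiler's moves in one graph into moves in the other.\<close>

lemma separable_swap:
  assumes "separable W G xs G' ys" and "length xs = length ys"
  shows "separable (map exchange ` W) G' ys G xs"
proof -
  obtain \<Phi> where \<Phi>: "free_vars \<Phi> \<subseteq> {..<length xs}" "Nest \<Phi> \<subseteq> W"
    "sat G ((!) xs) \<Phi>" "\<not> sat G' ((!) ys) \<Phi>"
    using assms(1) unfolding separable_def by blast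
  then show ?thesis
    unfolding separable_def using assms(2) by (intro exI[of _ "Neg \<Phi>"]) auto
qed

text \<open>Conjoining the separators adds no new word, since \<open>Nest\<close> of a conjunction
  is a union.\<close>

lemma common_separator:
  assumes "finite B" and "B \<noteq> {}"
    and "\<And>b. b \<in> B \<Longrightarrow>
      \<exists>\<Phi>. free_vars \<Phi> \<subseteq> X \<and> Nest \<Phi> \<subseteq> W \<and> sat G s \<Phi> \<and> \<not> sat G' (f b) \<Phi>"
  shows "\<exists>\<Phi>. free_vars \<Phi> \<subseteq> X \<and> Nest \<Phi> \<subseteq> W \<and> sat G s \<Phi> \<and> (\<forall>b\<in>B. \<not> sat G' (f b) \<Phi>)"
  using assms
proof (induction B rule: finite_ne_induct)
  case (singleton b)
  then show ?case by simp
next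
  case (insert b B)
  obtain \<Phi> where \<Phi>: "free_vars \<Phi> \<subseteq> X" "Nest \<Phi> \<subseteq> W" "sat G s \<Phi>" "\<forall>b\<in>B. \<not> sat G' (f b) \<Phi>"
    using insert.IH insert.prems by (meson insertCI)
  obtain \<Psi> where \<Psi>: "free_vars \<Psi> \<subseteq> X" "Nest \<Psi> \<subseteq> W" "sat G s \<Psi>" "\<not> sat G' (f b) \<Psi>"
    using insert.prems by (meson insertI1)
  show ?case using \<Phi> \<Psi> by (intro exI[of _ "Conj \<Phi> \<Psi>"]) auto
qed

text \<open>Spoiler's move \<open>v\<close> becomes an existential quantifier over the fresh
  variable \<open>length xs\<close>, in front of a conjunction refuting every reply of
  Duplicator.\<close>

lemma separable_Exi:
  assumes fin: "finite (pverts G')" "pverts G' \<noteq> {}" and len: "length xs = length ys"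
    and v: "v \<in> pverts G"
    and sep: "\<And>v'. v' \<in> pverts G' \<Longrightarrow> separable W G (xs @ [v]) G' (ys @ [v'])"
  shows "separable ((#) QEx ` W) G xs G' ys"
proof -
  let ?k = "length xs"
  have "\<exists>\<Phi>. free_vars \<Phi> \<subseteq> {..<Suc ?k} \<and> Nest \<Phi> \<subseteq> W \<and> sat G ((!) (xs @ [v])) \<Phi> \<and>
      (\<forall>v'\<in>pverts G'. \<not> sat G' ((!) (ys @ [v'])) \<Phi>)"
    using sep unfolding separable_def by (intro common_separator fin) auto
  then obtain \<Phi> where \<Phi>: "free_vars \<Phi> \<subseteq> {..<Suc ?k}" "Nest \<Phi> \<subseteq> W" "sat G ((!) (xs @ [v])) \<Phi>"
    "\<forall>v'\<in>pverts G'. \<not> sat G' ((!) (ys @ [v'])) \<Phi>"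
    by blast
  \<comment> \<open>Beyond index \<open>?k\<close> the two assignments need not agree, so only free
    variables are compared.\<close>
  have "sat G (((!) xs)(?k := v)) \<Phi> \<longleftrightarrow> sat G ((!) (xs @ [v])) \<Phi>"
    using \<Phi>(1) by (intro sat_cong) (auto simp: nth_append less_Suc_eq dest!: subsetD)
  moreover have "sat G' (((!) ys)(?k := v')) \<Phi> \<longleftrightarrow> sat G' ((!) (ys @ [v'])) \<Phi>" for v'
    using \<Phi>(1) len by (intro sat_cong) (auto simp: nth_append less_Suc_eq dest!: subsetD)
  ultimately show ?thesis
    unfolding separable_def using \<Phi> v by (intro exI[of _ "Exi ?k \<Phi>"]) (auto simp: less_Suc_eq)
qed

lemma separable_Exis:
  assumes "finite (pverts G')" "pverts G' \<noteq> {}" and "length xs = length ys"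
    and "set vs \<subseteq> pverts G"
    and "\<And>vs'. length vs' = length vs \<Longrightarrow> set vs' \<subseteq> pverts G' \<Longrightarrow>
      separable W G (xs @ vs) G' (ys @ vs')"
  shows "separable ((@) (replicate (length vs) QEx) ` W) G xs G' ys"
  using assms(3-)
proof (induction vs arbitrary: xs ys)
  case Nil
  from Nil(3)[of "[]"] show ?case by simp
next
  case (Cons v vs)
  have "separable ((@) (replicate (length vs) QEx) ` W) G (xs @ [v]) G' (ys @ [v'])"
    if "v' \<in> pverts G'" for v'
  proof (rule Cons.IH)
    fix vs' assume "length vs' = length vs" "set vs' \<subseteq> pverts G'"
    then show "separable W G ((xs @ [v]) @ vs) G' ((ys @ [v']) @ vs')"
      using Cons.prems(3)[of "v' # vs'"] that by simp
  qed (use Cons.prems in auto)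
  then have "separable ((#) QEx ` (@) (replicate (length vs) QEx) ` W) G xs G' ys"
    using Cons.prems assms(1,2) by (intro separable_Exi[where v = v]) auto
  then show ?case by (simp add: image_image)
qed

section \<open>The Ehrenfeucht game with all moves in one graph\<close>

definition partial_iso ::
  "'a pair_pre_digraph \<Rightarrow> 'a list \<Rightarrow> 'b pair_pre_digraph \<Rightarrow> 'b list \<Rightarrow> bool" where
  "partial_iso G xs G' ys \<longleftrightarrow> length xs = length ys \<and>
    (\<forall>i<length xs. \<forall>j<length xs. (xs ! i = xs ! j \<longleftrightarrow> ys ! i = ys ! j) \<and>
      ((xs ! i, xs ! j) \<in> parcs G \<longleftrightarrow> (ys ! i, ys ! j) \<in> parcs G'))"

text \<open>Duplicator survives \<open>m\<close> rounds of the Ehrenfeucht game in which Spoiler plays only in \<open>G\<close>.\<close>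

fun survives ::
  "nat \<Rightarrow> 'a pair_pre_digraph \<Rightarrow> 'a list \<Rightarrow> 'b pair_pre_digraph \<Rightarrow> 'b list \<Rightarrow> bool" where
  "survives 0 G xs G' ys \<longleftrightarrow> partial_iso G xs G' ys"
| "survives (Suc m) G xs G' ys \<longleftrightarrow> partial_iso G xs G' ys \<and>
    (\<forall>v\<in>pverts G. \<exists>v'\<in>pverts G'. survives m G (xs @ [v]) G' (ys @ [v']))"

lemma separable_atomic:
  assumes "length xs = length ys" and "\<not> partial_iso G xs G' ys"
  shows "separable {[]} G xs G' ys"
proof -
  obtain i j where ij: "i < length xs" "j < length xs" and
    "(xs ! i = xs ! j) \<noteq> (ys ! i = ys ! j) \<or>
     ((xs ! i, xs ! j) \<in> parcs G) \<noteq> ((ys ! i, ys ! j) \<in> parcs G')"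
    using assms unfolding partial_iso_def by blast
  then have "\<exists>\<Phi>\<in>{Equal i j, Neg (Equal i j), Adj i j, Neg (Adj i j)}.
      sat G ((!) xs) \<Phi> \<and> \<not> sat G' ((!) ys) \<Phi>"
    by auto
  moreover have "free_vars \<Phi> \<subseteq> {..<length xs} \<and> Nest \<Phi> \<subseteq> {[]}"
    if "\<Phi> \<in> {Equal i j, Neg (Equal i j), Adj i j, Neg (Adj i j)}" for \<Phi>
    using that ij by auto
  ultimately show ?thesis unfolding separable_def by blast
qed

text \<open>A winning strategy of Spoiler unfolds into a formula. Words may be shorter than
  \<open>m\<close> because the game can be decided before the last round.\<close>

lemma separable_if_not_survives:
  assumes "finite (pverts G')" "pverts G' \<noteq> {}" "length xs = length ys"
    and "\<not> survives m G xs G' ys"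
  shows "separable ((\<lambda>j. replicate j QEx) ` {..m}) G xs G' ys"
  using assms(3,4)
proof (induction m arbitrary: xs ys)
  case 0
  then show ?case using separable_atomic[of xs ys G G'] by simp
next
  case (Suc m)
  show ?case
  proof (cases "partial_iso G xs G' ys")
    case False
    show ?thesis
      by (rule separable_mono[OF separable_atomic[OF Suc.prems(1) False]])
        (auto intro: rev_image_eqI[of 0])
  next
    case True
    then obtain v where v: "v \<in> pverts G"
      "\<And>v'. v' \<in> pverts G' \<Longrightarrow> \<not> survives m G (xs @ [v]) G' (ys @ [v'])"
      using Suc.prems by auto
    have "separable ((#) QEx ` (\<lambda>j. replicate j QEx) ` {..m}) G xs G' ys"
      by (rule separable_Exi[OF assms(1,2) Suc.prems(1) v(1)])
        (use Suc.IH v(2) Suc.prems(1) in simp)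
    then show ?thesis
      by (rule separable_mono) (auto simp flip: replicate_Suc)
  qed
qed

lemma survives_partial_iso: "survives m G xs G' ys \<Longrightarrow> partial_iso G xs G' ys"
  by (cases m) auto

lemma survives_appendE:
  assumes "survives m G xs G' ys" and "set vs \<subseteq> pverts G" and "length vs \<le> m"
  obtains vs' where "length vs' = length vs" "set vs' \<subseteq> pverts G'"
    "survives (m - length vs) G (xs @ vs) G' (ys @ vs')"
  using assms
proof (induction vs arbitrary: m xs ys thesis)
  case Nil
  from Nil.prems(1)[of "[]"] Nil.prems(2) show ?case by simp
next
  case (Cons v vs)
  obtain m' where m: "m = Suc m'" using Cons.prems by (cases m) auto
  then obtain v' where v': "v' \<in> pverts G'" "survives m' G (xs @ [v]) G' (ys @ [v'])"
    using Cons.prems by auto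
  obtain vs' where "length vs' = length vs" "set vs' \<subseteq> pverts G'"
    "survives (m' - length vs) G ((xs @ [v]) @ vs) G' ((ys @ [v']) @ vs')"
    using Cons.IH[OF _ v'(2)] Cons.prems m by auto
  then show ?case using Cons.prems(1)[of "v' # vs'"] v'(1) m by simp
qed

section \<open>Adjacency types, single vertices and full types\<close>

definition outside :: "'a pair_pre_digraph \<Rightarrow> 'a list \<Rightarrow> 'a set" where
  "outside G xs = pverts G - set xs"

text \<open>Recording indices rather than vertices makes types in different graphs
  comparable.\<close>

definition adj_type :: "'a pair_pre_digraph \<Rightarrow> 'a list \<Rightarrow> 'a \<Rightarrow> nat set" where
  "adj_type G xs z = {i. i < length xs \<and> (xs ! i, z) \<in> parcs G}"

definition singles :: "'a pair_pre_digraph \<Rightarrow> 'a list \<Rightarrow> 'a set" where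
  "singles G xs =
    {y \<in> outside G xs. \<forall>u\<in>outside G xs. adj_type G xs u = adj_type G xs y \<longrightarrow> u = y}"

text \<open>Single vertices are named by their adjacency types, so full types are comparable across
  graphs too.\<close>

definition full_type :: "'a pair_pre_digraph \<Rightarrow> 'a list \<Rightarrow> 'a \<Rightarrow> nat set \<times> nat set set" where
  "full_type G xs z =
    (adj_type G xs z, adj_type G xs ` {y \<in> singles G xs. (y, z) \<in> parcs G})"

lemma fst_full_type [simp]: "fst (full_type G xs z) = adj_type G xs z"
  unfolding full_type_def by simp

definition full_class :: "'a pair_pre_digraph \<Rightarrow> 'a list \<Rightarrow> nat set \<times> nat set set \<Rightarrow> 'a set" where
  "full_class G xs p = {z \<in> outside G xs. full_type G xs z = p}"

lemma partial_iso_append: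
  assumes "partial_iso G (xs @ vs) G' (ys @ ws)" and "length xs = length ys"
  shows "length vs = length ws"
    and "i < length vs \<Longrightarrow> adj_type G xs (vs ! i) = adj_type G' ys (ws ! i)"
    and "i < length vs \<Longrightarrow> vs ! i \<in> set xs \<longleftrightarrow> ws ! i \<in> set ys"
    and "i < length vs \<Longrightarrow> j < length vs \<Longrightarrow> vs ! i = vs ! j \<longleftrightarrow> ws ! i = ws ! j"
    and "i < length vs \<Longrightarrow> j < length vs \<Longrightarrow>
      (vs ! i, vs ! j) \<in> parcs G \<longleftrightarrow> (ws ! i, ws ! j) \<in> parcs G'"
proof -
  let ?k = "length xs"
  show len: "length vs = length ws" using assms unfolding partial_iso_def by simp
  have *: "((xs @ vs) ! i = (xs @ vs) ! j \<longleftrightarrow> (ys @ ws) ! i = (ys @ ws) ! j) \<and>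
      (((xs @ vs) ! i, (xs @ vs) ! j) \<in> parcs G \<longleftrightarrow> ((ys @ ws) ! i, (ys @ ws) ! j) \<in> parcs G')"
    if "i < ?k + length vs" "j < ?k + length vs" for i j
    using assms(1) that unfolding partial_iso_def by simp
  have eq: "xs ! j = vs ! i \<longleftrightarrow> ys ! j = ws ! i"
    and adj: "(xs ! j, vs ! i) \<in> parcs G \<longleftrightarrow> (ys ! j, ws ! i) \<in> parcs G'"
    if "j < ?k" "i < length vs" for i j
    using *[of j "?k + i"] that assms(2) by (auto simp: nth_append)
  show "adj_type G xs (vs ! i) = adj_type G' ys (ws ! i)" if "i < length vs"
    unfolding adj_type_def using adj[OF _ that] assms(2) by auto
  show "vs ! i \<in> set xs \<longleftrightarrow> ws ! i \<in> set ys" if "i < length vs"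
    unfolding in_set_conv_nth using eq[OF _ that] assms(2) by auto
  show "vs ! i = vs ! j \<longleftrightarrow> ws ! i = ws ! j"
    and "(vs ! i, vs ! j) \<in> parcs G \<longleftrightarrow> (ws ! i, ws ! j) \<in> parcs G'"
    if "i < length vs" "j < length vs"
    using *[of "?k + i" "?k + j"] that assms(2) by (auto simp: nth_append)
qed

text \<open>The first move selects \<open>v\<close>, the second tests the reply \<open>v'\<close>
  against an arbitrary \<open>u\<close>. So one \<open>v'\<close> has to serve all
  \<open>u\<close>.\<close>

lemma survives_two:
  assumes surv: "survives m G xs G' ys" and m: "2 \<le> m"
    and v: "v \<in> outside G xs"
  obtains v' where "v' \<in> outside G' ys" "adj_type G xs v = adj_type G' ys v'"
    "\<And>u. u \<in> outside G xs \<Longrightarrow> \<exists>u'\<in>outside G' ys. adj_type G xs u = adj_type G' ys u' \<and>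
      (v = u \<longleftrightarrow> v' = u') \<and> ((v, u) \<in> parcs G \<longleftrightarrow> (v', u') \<in> parcs G') \<and>
      ((u, v) \<in> parcs G \<longleftrightarrow> (u', v') \<in> parcs G')"
proof -
  obtain k where k: "m = Suc (Suc k)" using m by (metis Suc_le_D numeral_2_eq_2 Suc_le_mono)
  obtain v' where v': "v' \<in> pverts G'" "survives (Suc k) G (xs @ [v]) G' (ys @ [v'])"
    using surv v unfolding k by (auto simp: outside_def)
  have len: "length xs = length ys"
    using survives_partial_iso[OF surv] unfolding partial_iso_def by simp
  note p = partial_iso_append[OF survives_partial_iso[OF v'(2)] len]
  show thesis
  proof (rule that)
    show "v' \<in> outside G' ys" "adj_type G xs v = adj_type G' ys v'"
      using p(2)[of 0] p(3)[of 0] v v'(1) by (auto simp: outside_def)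
    fix u assume u: "u \<in> outside G xs"
    obtain u' where u': "u' \<in> pverts G'" "survives k G (xs @ [v, u]) G' (ys @ [v', u'])"
      using v'(2) u by (auto simp: outside_def)
    note q = partial_iso_append[OF survives_partial_iso[OF u'(2)] len]
    show "\<exists>u'\<in>outside G' ys. adj_type G xs u = adj_type G' ys u' \<and>
      (v = u \<longleftrightarrow> v' = u') \<and> ((v, u) \<in> parcs G \<longleftrightarrow> (v', u') \<in> parcs G') \<and>
      ((u, v) \<in> parcs G \<longleftrightarrow> (u', v') \<in> parcs G')"
      using q(2)[of 1] q(3)[of 1] q(4)[of 0 1] q(5)[of 0 1] q(5)[of 1 0] u u'(1)
      by (intro bexI[of _ u']) (auto simp: outside_def)
  qed
qed

text \<open>If \<open>y'\<close> shared its type with another \<open>u'\<close>, Spoiler would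
  select both in \<open>G'\<close>, and Duplicator would need two distinct vertices of the type of
  \<open>y\<close>.\<close>

lemma singles_transfer:
  assumes "survives m G' ys G xs" "2 \<le> m"
    and "y \<in> singles G xs" "y' \<in> outside G' ys" "adj_type G xs y = adj_type G' ys y'"
  shows "y' \<in> singles G' ys"
proof -
  have "u' = y'" if u': "u' \<in> outside G' ys" "adj_type G' ys u' = adj_type G' ys y'" for u'
  proof -
    obtain v where v: "v \<in> outside G xs" "adj_type G' ys y' = adj_type G xs v"
      "\<exists>u\<in>outside G xs. adj_type G' ys u' = adj_type G xs u \<and> (y' = u' \<longleftrightarrow> v = u)"
      using survives_two[OF assms(1,2,4)] u'(1) by metis
    moreover have "w = y" if "w \<in> outside G xs" "adj_type G xs w = adj_type G' ys y'" for w
      using that assms(3,5) unfolding singles_def by simp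
    ultimately show ?thesis using u'(2) by metis
  qed
  then show ?thesis using assms(4) unfolding singles_def by blast
qed

text \<open>For a single vertex \<open>u\<close> the counterpart in the last assumption is the only
  vertex of its type, so adjacency to single vertices is transported.\<close>

lemma full_type_eqI:
  assumes surv: "survives m G xs G' ys" "survives m G' ys G xs" "2 \<le> m"
    and z: "adj_type G xs z = adj_type G' ys z'"
    and *: "\<And>u. u \<in> outside G xs \<Longrightarrow> \<exists>u'\<in>outside G' ys. adj_type G xs u = adj_type G' ys u' \<and>
      ((u, z) \<in> parcs G \<longleftrightarrow> (u', z') \<in> parcs G')"
  shows "full_type G xs z = full_type G' ys z'"
proof -
  have "\<tau> \<in> adj_type G xs ` {y \<in> singles G xs. (y, z) \<in> parcs G} \<longleftrightarrow>
        \<tau> \<in> adj_type G' ys ` {y \<in> singles G' ys. (y, z') \<in> parcs G'}" for \<tau>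
  proof
    assume "\<tau> \<in> adj_type G xs ` {y \<in> singles G xs. (y, z) \<in> parcs G}"
    then obtain y where y: "y \<in> singles G xs" "(y, z) \<in> parcs G" "\<tau> = adj_type G xs y" by auto
    then obtain y' where y': "y' \<in> outside G' ys" "adj_type G xs y = adj_type G' ys y'"
      "(y', z') \<in> parcs G'"
      using *[of y] unfolding singles_def by auto
    then show "\<tau> \<in> adj_type G' ys ` {y \<in> singles G' ys. (y, z') \<in> parcs G'}"
      using singles_transfer[OF surv(2,3) y(1)] y by auto
  next
    assume "\<tau> \<in> adj_type G' ys ` {y \<in> singles G' ys. (y, z') \<in> parcs G'}"
    then obtain y' where y': "y' \<in> singles G' ys" "(y', z') \<in> parcs G'" "\<tau> = adj_type G' ys y'"
      by auto
    then have "y' \<in> outside G' ys" unfolding singles_def by simp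
    \<comment> \<open>The last assumption leads from \<open>G\<close> to \<open>G'\<close> only, so
      \<open>y'\<close> is first traced back to some \<open>y\<close> of its type; the counterpart
      of \<open>y\<close> must then be \<open>y'\<close>.\<close>
    then obtain y where y: "y \<in> outside G xs" "adj_type G' ys y' = adj_type G xs y"
      using survives_two[OF surv(2,3)] by metis
    then have ys: "y \<in> singles G xs" using singles_transfer[OF surv(1,3) y'(1)] by simp
    obtain y'' where y'': "y'' \<in> outside G' ys" "adj_type G xs y = adj_type G' ys y''"
      "(y, z) \<in> parcs G \<longleftrightarrow> (y'', z') \<in> parcs G'"
      using *[OF y(1)] by auto
    then have "y'' = y'" using y y'(1) unfolding singles_def by auto
    then show "\<tau> \<in> adj_type G xs ` {y \<in> singles G xs. (y, z) \<in> parcs G}"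
      using y'' y' ys by auto
  qed
  then show ?thesis unfolding full_type_def using z by blast
qed

lemma full_type_exists:
  assumes surv: "survives m G xs G' ys" "survives m G' ys G xs" "2 \<le> m"
    and "z \<in> outside G xs"
  obtains z' where "z' \<in> outside G' ys" "full_type G' ys z' = full_type G xs z"
proof -
  obtain z' where z': "z' \<in> outside G' ys" "adj_type G xs z = adj_type G' ys z'"
    "\<And>u. u \<in> outside G xs \<Longrightarrow> \<exists>u'\<in>outside G' ys. adj_type G xs u = adj_type G' ys u' \<and>
      ((u, z) \<in> parcs G \<longleftrightarrow> (u', z') \<in> parcs G')"
    using survives_two[OF surv(1,3) assms(4)] by metis
  then show ?thesis using full_type_eqI[OF surv z'(2)] that by metis
qed

text \<open>
  Spoiler selects one more vertex of the class than the other graph has. One of the replies has the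
  wrong full type, which takes one more move to exploit unless the full type is determined by the
  adjacency type.
\<close>

lemma card_full_class_le:
  assumes surv: "survives m G xs G' ys" "survives m G' ys G xs" "2 \<le> m"
    and fin: "finite (pverts G)" "finite (pverts G')"
    and m: "card (full_class G' ys p) + 2 \<le> m \<or> card (full_class G' ys p) + 1 \<le> m \<and>
      (\<forall>z\<in>outside G xs. \<forall>z'\<in>outside G' ys. adj_type G xs z = adj_type G' ys z' \<longrightarrow>
        full_type G xs z = full_type G' ys z')"
  shows "card (full_class G xs p) \<le> card (full_class G' ys p)"
proof (rule ccontr)
  let ?j = "card (full_class G' ys p)"
  assume "\<not> ?thesis"
  then obtain Q where Q: "Q \<subseteq> full_class G xs p" "card Q = Suc ?j"
    by (meson not_less_eq_eq obtain_subset_with_card_n)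
  have "finite Q" using Q(2) card.infinite by fastforce
  then obtain vs where vs: "set vs = Q" "distinct vs" using finite_distinct_list by blast
  then have lvs: "length vs = Suc ?j" using Q(2) distinct_card by metis
  have out: "vs ! i \<in> outside G xs" "full_type G xs (vs ! i) = p" if "i < length vs" for i
    using that vs(1) Q(1) nth_mem[of i vs] unfolding full_class_def by blast+
  have "set vs \<subseteq> pverts G" using vs(1) Q(1) unfolding full_class_def outside_def by auto
  moreover have "length vs \<le> m" using m lvs by auto
  ultimately obtain ws where ws: "length ws = length vs" "set ws \<subseteq> pverts G'"
    "survives (m - length vs) G (xs @ vs) G' (ys @ ws)"
    using survives_appendE[OF surv(1)] by blast
  have len: "length xs = length ys"
    using survives_partial_iso[OF surv(1)] unfolding partial_iso_def by simp
  note q = partial_iso_append[OF survives_partial_iso[OF ws(3)] len]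
  have wout: "ws ! i \<in> outside G' ys" if "i < length vs" for i
    using q(3)[OF that] out(1)[OF that] ws(1,2) nth_mem[of i ws] that unfolding outside_def by auto
  have "distinct ws"
    using vs(2) q(4) ws(1) unfolding distinct_conv_nth by metis
  then have "card (set ws) = Suc ?j" using ws(1) lvs distinct_card by metis
  moreover have "finite (full_class G' ys p)"
    using fin(2) unfolding full_class_def outside_def by auto
  ultimately have "\<not> set ws \<subseteq> full_class G' ys p"
    using card_mono[of "full_class G' ys p" "set ws"] by auto
  then obtain i where i: "i < length vs" "ws ! i \<notin> full_class G' ys p"
    using ws(1) by (metis in_set_conv_nth subsetI)
  then have ne: "full_type G xs (vs ! i) \<noteq> full_type G' ys (ws ! i)"
    using wout out unfolding full_class_def by auto
  show False
  proof (cases "?j + 2 \<le> m")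
    case False
    \<comment> \<open>Only the second alternative of \<open>m\<close> remains: replies keep
      adjacency types, hence full types.\<close>
    then show ?thesis using m ne i(1) out(1) wout q(2) by metis
  next
    case True
    \<comment> \<open>Of the \<open>m\<close> moves \<open>?j + 1\<close> are spent; one is left to
      test the replies against any \<open>u\<close>.\<close>
    then obtain k where k: "m - length vs = Suc k"
      using lvs by (metis Suc_diff_Suc add_2_eq_Suc' less_eq_Suc_le)
    have "full_type G xs (vs ! i) = full_type G' ys (ws ! i)"
    proof (rule full_type_eqI[OF surv q(2)[OF i(1)]])
      fix u assume u: "u \<in> outside G xs"
      then obtain u' where u': "u' \<in> pverts G'"
        "survives k G (xs @ (vs @ [u])) G' (ys @ (ws @ [u']))"
        using ws(3) unfolding k by (auto simp: outside_def)
      note r = partial_iso_append[OF survives_partial_iso[OF u'(2)] len]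
      show "\<exists>u'\<in>outside G' ys. adj_type G xs u = adj_type G' ys u' \<and>
          ((u, vs ! i) \<in> parcs G \<longleftrightarrow> (u', ws ! i) \<in> parcs G')"
        using r(2,3)[of "length vs"] r(5)[of "length vs" i] i(1) ws(1) u u'(1)
        by (intro bexI[of _ u']) (auto simp: outside_def nth_append)
    qed
    then show ?thesis using ne by simp
  qed
qed

section \<open>Maximal splitting sequences and homogeneity\<close>

definition splitting :: "'a pair_pre_digraph \<Rightarrow> 'a list \<Rightarrow> bool" where
  "splitting G xs \<longleftrightarrow> distinct xs \<and> set xs \<subseteq> pverts G \<and>
    length xs < card (adj_type G xs ` outside G xs)"

text \<open>The empty sequence qualifies, as some type is realized, and distinctness bounds the
  length; take a longest one.\<close>

lemma maximal_splitting_exists: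
  assumes "finite (pverts G)" and "pverts G \<noteq> {}"
  obtains xs where "splitting G xs" "\<And>v. \<not> splitting G (xs @ [v])"
proof -
  have "splitting G []"
    using assms unfolding splitting_def outside_def adj_type_def by (simp add: card_gt_0_iff)
  moreover have "length xs \<le> card (pverts G)" if "splitting G xs" for xs
    using that card_mono[OF assms(1), of "set xs"] distinct_card[of xs]
    unfolding splitting_def by simp
  ultimately obtain xs where "splitting G xs"
    "\<And>zs. splitting G zs \<Longrightarrow> length zs \<le> length xs"
    using ex_has_greatest_nat[of "splitting G" "[]" length "Suc (card (pverts G))"] by (metis less_Suc_eq_le)
  then show thesis using that by (metis length_append_singleton not_less_eq_eq order_refl)
qed

text \<open>Otherwise appending \<open>v\<close> would split the type of \<open>z1\<close> and
  \<open>z2\<close> without losing the type of \<open>v\<close>, which another vertex shares, so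
  \<open>xs @ [v]\<close> would again be splitting.\<close>

lemma homogeneous:
  assumes "finite (pverts G)" and xs: "splitting G xs" "\<not> splitting G (xs @ [v])"
    and v: "v \<in> outside G xs" "v \<notin> singles G xs"
    and z: "z1 \<in> outside G xs" "z2 \<in> outside G xs" "z1 \<noteq> v" "z2 \<noteq> v"
      "adj_type G xs z1 = adj_type G xs z2"
  shows "(v, z1) \<in> parcs G \<longleftrightarrow> (v, z2) \<in> parcs G"
proof (rule ccontr)
  assume ne: "\<not> ?thesis"
  let ?t = "adj_type G (xs @ [v])" and ?B = "outside G xs - {v}"
  \<comment> \<open>\<open>?h\<close> forgets the adjacency to \<open>v\<close>, mapping types over
    \<open>xs @ [v]\<close> to types over \<open>xs\<close>.\<close>
  let ?h = "\<lambda>T. T \<inter> {..<length xs}"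
  have t: "?t z = adj_type G xs z \<union> (if (v, z) \<in> parcs G then {length xs} else {})" for z
    unfolding adj_type_def by (auto simp: nth_append less_Suc_eq)
  have h: "?h (?t z) = adj_type G xs z" for z
    unfolding t by (auto simp: adj_type_def)
  have B: "outside G (xs @ [v]) = ?B" unfolding outside_def by auto
  have fin: "finite (?t ` ?B)" using assms(1) unfolding outside_def by simp
  obtain u where u: "u \<in> ?B" "adj_type G xs u = adj_type G xs v"
    using v unfolding singles_def by auto
  have "?h ` ?t ` ?B = adj_type G xs ` ?B"
    unfolding image_image using h by simp
  also have "\<dots> = adj_type G xs ` outside G xs"
    using u by (auto intro: rev_image_eqI)
  finally have img: "?h ` ?t ` ?B = adj_type G xs ` outside G xs" .
  have "\<not> inj_on ?h (?t ` ?B)"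
  proof
    assume inj: "inj_on ?h (?t ` ?B)"
    have "?t z1 = ?t z2"
      by (rule inj_onD[OF inj]) (use z h in auto)
    moreover have "length xs \<in> ?t z \<longleftrightarrow> (v, z) \<in> parcs G" for z
      unfolding adj_type_def by simp
    ultimately show False using ne by metis
  qed
  then have "card (?h ` ?t ` ?B) < card (?t ` ?B)"
    using card_image_le[OF fin, of ?h] eq_card_imp_inj_on[OF fin, of ?h] by linarith
  then have "splitting G (xs @ [v])"
    using xs(1) v(1) unfolding splitting_def B img by (auto simp: outside_def)
  then show False using xs(2) by simp
qed

text \<open>Exchange one endpoint at a time, applying homogeneity to the endpoint that
  stays.\<close>

lemma homogeneous_pairs:
  assumes G: "pair_graph G" and xs: "splitting G xs" "\<And>v. \<not> splitting G (xs @ [v])"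
    and u: "u1 \<in> outside G xs - singles G xs" "u2 \<in> outside G xs - singles G xs" "u1 \<noteq> u2"
    and z: "z1 \<in> outside G xs - singles G xs" "z2 \<in> outside G xs - singles G xs" "z1 \<noteq> z2"
    and t: "adj_type G xs u1 = adj_type G xs z1" "adj_type G xs u2 = adj_type G xs z2"
  shows "(u1, u2) \<in> parcs G \<longleftrightarrow> (z1, z2) \<in> parcs G"
proof -
  interpret pair_graph G by (rule G)
  have sym: "(a, b) \<in> parcs G \<longleftrightarrow> (b, a) \<in> parcs G" for a b
    using arcs_symmetric by blast
  note hom = homogeneous[OF finite_verts xs]
  show ?thesis
  proof (cases "u1 = z2")
    case False
    then have "(u1, u2) \<in> parcs G \<longleftrightarrow> (u1, z2) \<in> parcs G"
      using hom[of u1 u2 z2] u z t by auto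
    also have "\<dots> \<longleftrightarrow> (z1, z2) \<in> parcs G"
      using hom[of z2 u1 z1] False u z t sym by auto
    finally show ?thesis .
  next
    case True
    \<comment> \<open>The intermediate pair \<open>(u1, z2)\<close> degenerates here, but all four
      vertices have the same type and one exchange suffices.\<close>
    then have "(z2, u2) \<in> parcs G \<longleftrightarrow> (z2, z1) \<in> parcs G"
      using hom[of z2 u2 z1] u z t by auto
    then show ?thesis using True sym by auto
  qed
qed

text \<open>The type of a single vertex identifies it among the vertices outside
  \<open>xs\<close>.\<close>

lemma single_adj_iff:
  assumes "y \<in> singles G xs"
  shows "(y, z) \<in> parcs G \<longleftrightarrow> adj_type G xs y \<in> snd (full_type G xs z)"
  using assms unfolding full_type_def singles_def by auto

section \<open>Isomorphism from equal class sizes\<close>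

text \<open>Glue the map from \<open>xs\<close> to \<open>ys\<close> with bijections between classes
  of equal full type. Adjacency is preserved on pairs meeting \<open>xs\<close> by the partial
  isomorphism and adjacency types, on pairs with a single vertex by full types, on the rest by
  homogeneity.\<close>

lemma iso_if_card_full_class_eq:
  assumes G: "pair_graph G" and G': "pair_graph G'"
    and surv: "survives m G xs G' ys" "survives m G' ys G xs" "2 \<le> m"
    and xs: "splitting G xs" "\<And>v. \<not> splitting G (xs @ [v])"
    and ys: "set ys \<subseteq> pverts G'"
    and card: "\<And>p. card (full_class G xs p) = card (full_class G' ys p)"
  shows "digraph_iso (with_proj G) (with_proj G')"
proof -
  interpret G: pair_graph G by (rule G)
  interpret G': pair_graph G' by (rule G')
  have sym: "(a, b) \<in> parcs G \<longleftrightarrow> (b, a) \<in> parcs G" for a b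
    using G.arcs_symmetric by blast
  have sym': "(a, b) \<in> parcs G' \<longleftrightarrow> (b, a) \<in> parcs G'" for a b
    using G'.arcs_symmetric by blast
  have pi: "partial_iso G xs G' ys" using survives_partial_iso[OF surv(1)] .
  then have len: "length xs = length ys" unfolding partial_iso_def by simp
  have dxs: "distinct xs" "set xs \<subseteq> pverts G" using xs(1) unfolding splitting_def by auto
  then have dys: "distinct ys"
    using pi unfolding partial_iso_def distinct_conv_nth by metis
  have "\<exists>g. bij_betw g (full_class G xs p) (full_class G' ys p)" for p
    by (rule finite_same_card_bij[OF _ _ card]) (auto simp: full_class_def outside_def)
  then obtain g where g: "\<And>p. bij_betw (g p) (full_class G xs p) (full_class G' ys p)"
    by metis
  define f where
    "f z = (if z \<in> set xs then the (map_of (zip xs ys) z) else g (full_type G xs z) z)" for z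
  have f_nth: "f (xs ! i) = ys ! i" if "i < length xs" for i
    using that len dxs(1) unfolding f_def by (simp add: map_of_zip_nth)
  have f_out: "f z \<in> outside G' ys" "full_type G' ys (f z) = full_type G xs z"
    if "z \<in> outside G xs" for z
  proof -
    have "z \<in> full_class G xs (full_type G xs z)" using that unfolding full_class_def by simp
    then have "g (full_type G xs z) z \<in> full_class G' ys (full_type G xs z)"
      using g bij_betwE by blast
    moreover have "f z = g (full_type G xs z) z"
      using that unfolding f_def outside_def by simp
    ultimately show "f z \<in> outside G' ys" "full_type G' ys (f z) = full_type G xs z"
      unfolding full_class_def by simp_all
  qed
  then have f_type: "adj_type G xs z = adj_type G' ys (f z)" if "z \<in> outside G xs" for z
    using that by (metis fst_full_type)
  have bij1: "bij_betw f (set xs) (set ys)"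
  proof (rule bij_betw_imageI)
    show "inj_on f (set xs)"
      using f_nth dys len by (auto simp: inj_on_def in_set_conv_nth nth_eq_iff_index_eq)
    show "f ` set xs = set ys"
      using f_nth len by (force simp: in_set_conv_nth image_iff)
  qed
  have bij2: "bij_betw f (outside G xs) (outside G' ys)"
  proof (rule bij_betw_imageI)
    have f_g: "f z = g p z" if "z \<in> full_class G xs p" for z p
      using that unfolding f_def full_class_def outside_def by auto
    show "inj_on f (outside G xs)"
    proof (rule inj_onI)
      fix a b assume ab: "a \<in> outside G xs" "b \<in> outside G xs" "f a = f b"
      let ?p = "full_type G xs a"
      have "a \<in> full_class G xs ?p" "b \<in> full_class G xs ?p"
        using ab f_out(2) unfolding full_class_def by (simp, metis (mono_tags, lifting) mem_Collect_eq)
      then show "a = b"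
        using g[of ?p] f_g ab(3) unfolding bij_betw_def by (metis inj_onD)
    qed
    show "f ` outside G xs = outside G' ys"
    proof
      show "f ` outside G xs \<subseteq> outside G' ys" using f_out by auto
      show "outside G' ys \<subseteq> f ` outside G xs"
      proof
        fix z' assume "z' \<in> outside G' ys"
        then have "z' \<in> full_class G' ys (full_type G' ys z')" unfolding full_class_def by simp
        then obtain z where "z \<in> full_class G xs (full_type G' ys z')"
          "z' = g (full_type G' ys z') z"
          using g unfolding bij_betw_def by (metis imageE)
        then have "z' = f z" "z \<in> outside G xs" using f_g by (simp_all add: full_class_def)
        then show "z' \<in> f ` outside G xs" by (rule image_eqI)
      qed
    qed
  qed
  have V: "pverts G = set xs \<union> outside G xs" "pverts G' = set ys \<union> outside G' ys"
    using dxs(2) ys unfolding outside_def by auto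
  have bij: "bij_betw f (pverts G) (pverts G')"
    unfolding V by (rule bij_betw_combine[OF bij1 bij2]) (auto simp: outside_def)
  have adj_in_out: "(xs ! i, v) \<in> parcs G \<longleftrightarrow> (ys ! i, f v) \<in> parcs G'"
    if "i < length xs" "v \<in> outside G xs" for i v
    using f_type[OF that(2)] that(1) len unfolding adj_type_def by auto
  have adj_single: "(u, v) \<in> parcs G \<longleftrightarrow> (f u, f v) \<in> parcs G'"
    if "u \<in> singles G xs" "v \<in> outside G xs" for u v
  proof -
    have u: "u \<in> outside G xs" using that(1) unfolding singles_def by simp
    have "f u \<in> singles G' ys"
      using singles_transfer[OF surv(2,3) that(1)] f_out(1)[OF u] f_type[OF u] by blast
    then show ?thesis
      using single_adj_iff[OF that(1)] single_adj_iff f_out(2)[OF that(2)] f_type[OF u] by metis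
  qed
  have adj_out: "(u, v) \<in> parcs G \<longleftrightarrow> (f u, f v) \<in> parcs G'"
    if u: "u \<in> outside G xs" and v: "v \<in> outside G xs" for u v
  proof -
    consider "u \<in> singles G xs" | "v \<in> singles G xs" | "u = v"
      | "u \<notin> singles G xs" "v \<notin> singles G xs" "u \<noteq> v" by blast
    then show ?thesis
    proof cases
      case 1
      then show ?thesis using adj_single v by blast
    next
      case 2
      then show ?thesis using adj_single u sym sym' by blast
    next
      case 3
      then show ?thesis
        using G.adj_not_same G'.adj_not_same by auto
    next
      case 4
      have ne: "f u \<noteq> f v" using 4 bij2 u v unfolding bij_betw_def by (meson inj_onD)
      \<comment> \<open>Homogeneity is known in \<open>G\<close> only. Spoiler therefore selects
        \<open>f u\<close> and \<open>f v\<close> in \<open>G'\<close>; the replies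
        \<open>a\<close>, \<open>b\<close> have the types of \<open>u\<close>, \<open>v\<close> and
        are compared with them inside \<open>G\<close>.\<close>
      obtain a where a: "a \<in> outside G xs" "adj_type G' ys (f u) = adj_type G xs a"
        "\<And>w. w \<in> outside G' ys \<Longrightarrow> \<exists>b\<in>outside G xs. adj_type G' ys w = adj_type G xs b \<and>
          (f u = w \<longleftrightarrow> a = b) \<and> ((f u, w) \<in> parcs G' \<longleftrightarrow> (a, b) \<in> parcs G)"
        using survives_two[OF surv(2,3) f_out(1)[OF u]] by metis
      obtain b where b: "b \<in> outside G xs" "adj_type G' ys (f v) = adj_type G xs b"
        "a \<noteq> b" "(f u, f v) \<in> parcs G' \<longleftrightarrow> (a, b) \<in> parcs G"
        using a(3)[OF f_out(1)[OF v]] ne by blast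
      have nonsingle: "c \<in> outside G xs - singles G xs"
        if "c \<in> outside G xs" "w \<in> outside G xs" "w \<notin> singles G xs"
          "adj_type G xs c = adj_type G xs w" for c w
      proof -
        have "\<exists>x\<in>outside G xs. adj_type G xs x = adj_type G xs c \<and> x \<noteq> c"
        proof (cases "c = w")
          case True
          then show ?thesis using that(2,3) unfolding singles_def by simp
        next
          case False
          then show ?thesis using that(2,4) by metis
        qed
        then show ?thesis using that(1) unfolding singles_def by simp
      qed
      have ta: "adj_type G xs a = adj_type G xs u" and tb: "adj_type G xs b = adj_type G xs v"
        using a(2) b(2) f_type u v by auto
      have "(a, b) \<in> parcs G \<longleftrightarrow> (u, v) \<in> parcs G"
        using u v 4 b(3) ta tb nonsingle[OF a(1) u 4(1) ta] nonsingle[OF b(1) v 4(2) tb]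
        by (intro homogeneous_pairs[OF G xs]) simp_all
      then show ?thesis using b(4) by simp
    qed
  qed
  have "(u, v) \<in> parcs G \<longleftrightarrow> (f u, f v) \<in> parcs G'" if uv: "u \<in> pverts G" "v \<in> pverts G" for u v
  proof -
    consider i j where "i < length xs" "j < length xs" "u = xs ! i" "v = xs ! j"
      | i where "i < length xs" "u = xs ! i" "v \<in> outside G xs"
      | j where "j < length xs" "v = xs ! j" "u \<in> outside G xs"
      | "u \<in> outside G xs" "v \<in> outside G xs"
      using uv unfolding V by (auto simp: in_set_conv_nth)
    then show ?thesis
    proof cases
      case 1
      then show ?thesis using pi f_nth unfolding partial_iso_def by simp
    next
      case 2
      then show ?thesis using adj_in_out f_nth by simp
    next
      case 3
      then show ?thesis using adj_in_out[of j u] f_nth sym sym' by simp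
    next
      case 4
      then show ?thesis using adj_out by simp
    qed
  qed
  then show ?thesis
    unfolding digraph_iso_pair_graph_iff[OF G G'] using bij by blast
qed

section \<open>Counting full classes against the number of moves\<close>

text \<open>Values other than \<open>p\<close> and \<open>q\<close> are taken on the rest of
  \<open>B\<close>, so they are at most as many as the elements left there.\<close>

lemma card_two_fibres_le:
  assumes "finite B" and "p \<noteq> q"
  shows "card {b \<in> B. f b = p} + card {b \<in> B. f b = q} + card (f ` B) \<le> card B + 2"
proof -
  let ?P = "{b \<in> B. f b = p}" and ?Q = "{b \<in> B. f b = q}"
  let ?R = "B - (?P \<union> ?Q)"
  have "card (?P \<union> ?Q) = card ?P + card ?Q"
    using assms by (intro card_Un_disjoint) auto
  moreover have "card B = card ?R + card (?P \<union> ?Q)"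
    using assms(1) by (subst card_Un_disjoint[symmetric]) (auto intro: arg_cong[of _ _ card])
  moreover have "card (f ` B) \<le> card ?R + 2"
  proof -
    have "f ` B \<subseteq> f ` ?R \<union> {p, q}" by auto
    then have "card (f ` B) \<le> card (f ` ?R \<union> {p, q})"
      using assms(1) by (intro card_mono) auto
    also have "\<dots> \<le> card (f ` ?R) + card {p, q}" by (rule card_Un_le)
    also have "\<dots> \<le> card ?R + 2"
      using card_image_le[of ?R f] assms by simp
    finally show ?thesis .
  qed
  ultimately show ?thesis by linarith
qed

text \<open>If no value were more frequent on \<open>A\<close>, summing fibre sizes would give
  \<open>card A < card B\<close>, with strictness coming from \<open>r\<close>.\<close>

lemma larger_fibre_exists:
  assumes "finite A" and "finite B" and "card A = card B"
    and ne: "card {a \<in> A. f a = r} \<noteq> card {b \<in> B. g b = r}"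
  obtains p where "card {b \<in> B. g b = p} < card {a \<in> A. f a = p}"
proof (rule ccontr)
  assume "\<not> thesis"
  then have le: "card {a \<in> A. f a = p} \<le> card {b \<in> B. g b = p}" for p
    using that by (meson not_le)
  let ?P = "insert r (f ` A \<union> g ` B)"
  have "(\<Sum>p\<in>?P. card {a \<in> A. f a = p}) < (\<Sum>p\<in>?P. card {b \<in> B. g b = p})"
    using assms(1,2) le ne by (intro sum_strict_mono_ex1) (auto simp: order.strict_iff_order)
  moreover have "(\<Sum>p\<in>?P. card {a \<in> A. f a = p}) = card A"
    using sum.group[of A ?P f "\<lambda>_. 1 :: nat"] assms(1,2) by (simp add: subset_insertI2)
  moreover have "(\<Sum>p\<in>?P. card {b \<in> B. g b = p}) = card B"
    using sum.group[of B ?P g "\<lambda>_. 1 :: nat"] assms(1,2) by (simp add: subset_insertI2)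
  ultimately show False using assms(3) by simp
qed

text \<open>Here \<open>m\<close> is the number of moves left after \<open>xs\<close>. The classes
  of \<open>p\<close> and \<open>q\<close> would have to be too large to exhaust, but every further
  full type in \<open>G\<close> takes up a vertex, and there are more than \<open>length xs\<close>
  types.\<close>

lemma duplicator_loses:
  assumes G: "pair_graph G" and G': "pair_graph G'"
    and n: "card (pverts G) = n" "card (pverts G') = n"
    and not_iso: "\<not> digraph_iso (with_proj G) (with_proj G')"
    and xs: "splitting G xs" "\<And>v. \<not> splitting G (xs @ [v])"
    and ys: "set ys \<subseteq> pverts G'"
    and m: "m + length xs = (n + 3) div 2"
    and surv: "survives m G xs G' ys" "survives m G' ys G xs"
  shows False
proof -
  interpret G: pair_graph G by (rule G)
  interpret G': pair_graph G' by (rule G')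
  let ?k = "length xs" and ?B = "outside G xs" and ?B' = "outside G' ys"
  let ?C = "full_class G xs" and ?C' = "full_class G' ys"
  have fin: "finite ?B" "finite ?B'" unfolding outside_def by auto
  have pi: "partial_iso G xs G' ys" using survives_partial_iso[OF surv(1)] .
  then have len: "?k = length ys" unfolding partial_iso_def by simp
  have dxs: "distinct xs" "set xs \<subseteq> pverts G" "?k < card (adj_type G xs ` ?B)"
    using xs(1) unfolding splitting_def by auto
  then have dys: "distinct ys"
    using pi unfolding partial_iso_def distinct_conv_nth by metis
  have "card (set xs) \<le> n" using card_mono[OF G.finite_verts dxs(2)] n by simp
  then have cB: "card ?B + ?k = n"
    using dxs(1,2) n(1) distinct_card[OF dxs(1)] unfolding outside_def by (simp add: card_Diff_subset)
  have cB': "card ?B' + ?k = n"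
    using dys ys n(2) distinct_card[OF dys] len \<open>card (set xs) \<le> n\<close> distinct_card[OF dxs(1)]
    unfolding outside_def by (simp add: card_Diff_subset)
  \<comment> \<open>Splitting gives \<open>2 * ?k + 1 \<le> n\<close>, so at least two of the
    \<open>(n + 3) div 2\<close> moves are left.\<close>
  have m2: "2 \<le> m"
    using dxs(3) card_image_le[OF fin(1), of "adj_type G xs"] cB m by linarith
  obtain r where r: "card (?C r) \<noteq> card (?C' r)"
    using iso_if_card_full_class_eq[OF G G' surv m2 xs ys] not_iso by blast
  have cBB': "card ?B = card ?B'" using cB cB' by simp
  obtain p where p: "card (?C' p) < card (?C p)"
    using larger_fibre_exists[OF fin cBB' r[unfolded full_class_def]] unfolding full_class_def .
  obtain q where q: "card (?C q) < card (?C' q)"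
    using larger_fibre_exists[OF fin(2,1) cBB'[symmetric] r[unfolded full_class_def, symmetric]]
    unfolding full_class_def .
  have "p \<noteq> q" using p q by auto
  have count: "card (?C p) + card (?C q) + card (full_type G xs ` ?B) \<le> card ?B + 2"
    using card_two_fibres_le[OF fin(1) \<open>p \<noteq> q\<close>] unfolding full_class_def .
  have fst: "fst ` full_type G xs ` ?B = adj_type G xs ` ?B"
    unfolding image_image by simp
  then have types: "card (adj_type G xs ` ?B) \<le> card (full_type G xs ` ?B)"
    using card_image_le[of "full_type G xs ` ?B" fst] fin(1) by simp
  note le = card_full_class_le[OF surv m2 G.finite_verts G'.finite_verts]
    card_full_class_le[OF surv(2,1) m2 G'.finite_verts G.finite_verts]
  show False
  proof (cases "\<forall>z\<in>?B. \<forall>z'\<in>?B'. adj_type G xs z = adj_type G' ys z' \<longrightarrow>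
      full_type G xs z = full_type G' ys z'")
    case True
    then have "m < card (?C' p) + 1" using le(1)[of p] p by force
    moreover have "m < card (?C q) + 1" using le(2)[of q] q True by force
    \<comment> \<open>The classes of \<open>p\<close> and \<open>q\<close> in \<open>G\<close> have
      at least \<open>m + 1\<close> and \<open>m\<close> elements. So \<open>count\<close> gives
      \<open>2 * (m + ?k) \<le> n\<close>, while the left side is at least \<open>n + 2\<close> by
      the choice of \<open>m\<close>.\<close>
    ultimately show ?thesis using p count types dxs(3) cB m by linarith
  next
    case False
    then obtain z z' where z: "z \<in> ?B" "z' \<in> ?B'" "adj_type G xs z = adj_type G' ys z'"
      "full_type G xs z \<noteq> full_type G' ys z'" by blast
    obtain v where v: "v \<in> ?B" "full_type G xs v = full_type G' ys z'"
      using full_type_exists[OF surv(2,1) m2 z(2)] by blast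
    \<comment> \<open>The vertices \<open>z\<close> and \<open>v\<close> of \<open>G\<close> share
      an adjacency type but not a full type, so there are more full types than adjacency
      types.\<close>
    have "\<not> inj_on fst (full_type G xs ` ?B)"
    proof
      assume inj: "inj_on fst (full_type G xs ` ?B)"
      have "fst (full_type G xs z) = fst (full_type G xs v)"
        using z(3) v(2) by (metis fst_full_type)
      then have "full_type G xs z = full_type G xs v" using inj_onD[OF inj] z(1) v(1) by blast
      then show False using z(4) v(2) by simp
    qed
    then have "card (adj_type G xs ` ?B) \<noteq> card (full_type G xs ` ?B)"
      using eq_card_imp_inj_on[of "full_type G xs ` ?B" fst] fin(1) fst by auto
    moreover have "m < card (?C' p) + 2" using le(1)[of p] p by force
    moreover have "m < card (?C q) + 2" using le(2)[of q] q by force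
    \<comment> \<open>Both bounds on \<open>m\<close> are weaker by one, but the extra full type
      regains one: \<open>2 * (m + ?k) \<le> n + 1\<close>, still below
      \<open>n + 2\<close>.\<close>
    ultimately show ?thesis using p count types dxs(3) cB m by linarith
  qed
qed

section \<open>Words with one alternation and the final bound\<close>

lemma word_alternations_replicate_append:
  "word_alternations (replicate i a @ replicate j b) \<le> 1"
proof -
  let ?w = "replicate i a @ replicate j b"
  \<comment> \<open>Letters can change only from position \<open>i - 1\<close> to \<open>i\<close>;
    for \<open>i = 0\<close> there is no change at all.\<close>
  have "{k. Suc k < length ?w \<and> ?w ! k \<noteq> ?w ! Suc k} \<subseteq> {i - 1}"
    by (auto simp: nth_append split: if_splits)
  from card_mono[OF _ this] show ?thesis unfolding word_alternations_def by simp
qed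

lemma D_1_le:
  assumes "separable {replicate i QEx @ replicate j a | i j a. i + j \<le> r} G [] G' []"
  shows "D 1 G G' \<le> enat r"
proof -
  obtain \<Phi> where \<Phi>: "free_vars \<Phi> = {}" "sat G ((!) []) \<Phi>" "\<not> sat G' ((!) []) \<Phi>"
    "Nest \<Phi> \<subseteq> {replicate i QEx @ replicate j a | i j a. i + j \<le> r}"
    using assms unfolding separable_def by auto
  have "distinguishes \<Phi> G G'"
    using \<Phi>(1-3) true_on_closed unfolding distinguishes_def closed_formula_def by metis
  moreover have "word_alternations w \<le> 1 \<and> length w \<le> r" if w: "w \<in> Nest \<Phi>" for w
  proof -
    obtain i j a where "w = replicate i QEx @ replicate j a" "i + j \<le> r"
      using w \<Phi>(4) by blast
    then show ?thesis using word_alternations_replicate_append by simp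
  qed
  then have "alternation_number \<Phi> \<le> 1" "quantifier_rank \<Phi> \<le> r"
    unfolding alternation_number_def quantifier_rank_def
    using finite_Nest Nest_nonempty by (auto simp: Max_le_iff)
  ultimately show ?thesis
    unfolding D_def by (intro INF_lower2[of \<Phi>]) auto
qed

theorem theorem3p15:
  fixes G :: "'a pair_pre_digraph" and G' :: "'b pair_pre_digraph" and n :: nat
  assumes "pair_graph G" and "pair_graph G'"
    and "card (pverts G) = n" and "card (pverts G') = n"
    and "\<not> digraph_iso (with_proj G) (with_proj G')"
  shows "ereal_of_enat (D 1 G G') \<le> ereal ((real n + 3) / 2)"
proof -
  interpret G: pair_graph G by (rule assms(1))
  interpret G': pair_graph G' by (rule assms(2))
  have ne: "pverts G \<noteq> {}"
  proof
    assume "pverts G = {}"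
    then have "pverts G = {}" "pverts G' = {}"
      using assms(3,4) card_0_eq[OF G'.finite_verts] by auto
    then have "digraph_iso (with_proj G) (with_proj G')"
      unfolding digraph_iso_pair_graph_iff[OF assms(1,2)] by (auto simp: bij_betw_def)
    then show False using assms(5) by simp
  qed
  then have ne': "pverts G' \<noteq> {}" using assms(3,4) by (metis G.finite_verts card_0_eq card.empty)
  obtain xs where xs: "splitting G xs" "\<And>v. \<not> splitting G (xs @ [v])"
    using maximal_splitting_exists[OF G.finite_verts ne] by blast
  let ?r = "(n + 3) div 2"
  have "distinct xs" "set xs \<subseteq> pverts G" "length xs < card (adj_type G xs ` outside G xs)"
    using xs(1) unfolding splitting_def by auto
  moreover from this have "card (outside G xs) + length xs = n"
    using assms(3) card_mono[OF G.finite_verts, of "set xs"] distinct_card[of xs]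
    unfolding outside_def by (simp add: card_Diff_subset)
  moreover have "card (adj_type G xs ` outside G xs) \<le> card (outside G xs)"
    by (rule card_image_le) (simp add: outside_def)
  ultimately have "length xs \<le> ?r" by linarith
  then obtain m where m: "m + length xs = ?r" by (metis le_add_diff_inverse2)
  let ?E = "\<lambda>a. (\<lambda>j. replicate j a) ` {..m}"
  \<comment> \<open>After \<open>xs\<close> Spoiler stays in one graph: existential words arise if
    it is \<open>G\<close>, universal ones, by negation, if it is \<open>G'\<close>.\<close>
  have "separable (?E QEx \<union> ?E QAll) G xs G' ys"
    if ys: "length ys = length xs" "set ys \<subseteq> pverts G'" for ys
  proof -
    have "\<not> survives m G xs G' ys \<or> \<not> survives m G' ys G xs"
      using duplicator_loses[OF assms xs ys(2) m] by blast
    then show ?thesis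
    proof
      assume "\<not> survives m G xs G' ys"
      then show ?thesis
        using separable_mono[OF separable_if_not_survives[OF G'.finite_verts ne' ys(1)[symmetric]]]
        by blast
    next
      assume "\<not> survives m G' ys G xs"
      then have "separable (map exchange ` ?E QEx) G xs G' ys"
        using separable_swap[OF separable_if_not_survives[OF G.finite_verts ne ys(1)] ys(1)]
        by blast
      then show ?thesis by (rule separable_mono) auto
    qed
  qed
  \<comment> \<open>Selecting \<open>xs\<close> puts one existential block in front of the final
    block.\<close>
  then have "separable ((@) (replicate (length xs) QEx) ` (?E QEx \<union> ?E QAll)) G [] G' []"
    using \<open>set xs \<subseteq> pverts G\<close> by (intro separable_Exis ne') auto
  then have "separable {replicate i QEx @ replicate j a | i j a. i + j \<le> ?r} G [] G' []"
    by (rule separable_mono) (use m in \<open>force simp: add.commute\<close>)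
  then have "D 1 G G' \<le> enat ?r" by (rule D_1_le)
  then have "ereal_of_enat (D 1 G G') \<le> ereal_of_enat (enat ?r)"
    by (simp only: ereal_of_enat_le_iff)
  also have "\<dots> \<le> ereal ((real n + 3) / 2)"
  proof -
    have "real (2 * ?r) \<le> real (n + 3)" by (simp only: of_nat_le_iff)
    then show ?thesis by simp
  qed
  finally show ?thesis .
qed

end
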